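(* Let $E$ be a real vector space, let $f\colon E\to\mathbb{R}$ be convex, and let $Z$ be a nonempty subset of $E$ such that, for all $z_1,z_2\in Z$, there exists $z\in Z$ such that $$\text{for all real }\rho\ge 0,\quad f\big(\rho\big[z-\tfrac12 z_1-\tfrac12 z_2\big]\big)\le f(0).$$ Then there exists an affine map $A\colon E\to\mathbb{R}$ such that $A\le f$ on $E$ and $\inf_Z A=\inf_Z f$.
   Context: All vector spaces are real. "Convex" and "affine" have their usual senses; in particular an affine map $A\colon E\to\mathbb{R}$ is a linear functional plus a real constant. $A\le f$ on $E$ means $A(x)\le f(x)$ for all $x\in E$. Infima are taken in $[-\infty,\infty[$, i.e. the value $-\infty$ is allowed, and $\inf_Z g$ denotes $\inf_{z\in Z}g(z)$. *)

theory Defs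
  imports "HOL-Analysis.Analysis"
begin

definition affine_map :: "('a::real_vector \<Rightarrow> real) \<Rightarrow> bool" where
  "affine_map A \<longleftrightarrow> (\<exists>L c. linear L \<and> A = (\<lambda>x. L x + c))"

end

theory Submission
  imports Defs
begin

text \<open>
  Write \<open>\<beta>\<close> for the infimum of \<open>f\<close> on \<open>Z\<close>. If \<open>\<beta>\<close> is \<open>-\<infinity>\<close>, any affine minorant of \<open>f\<close> will do.
  Otherwise an affine \<open>A\<close> with \<open>A \<le> f\<close> and \<open>A \<ge> \<beta>\<close> on \<open>Z\<close> is wanted. An affine \<open>A\<close> that is at
  least \<open>\<beta>\<close> on \<open>Z\<close> is so on the convex hull of \<open>Z\<close>, hence \<open>f \<ge> \<beta>\<close> on this hull is necessary;
  the sandwich theorem \<open>affine_sandwich\<close> says that it is also sufficient.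

  That \<open>f \<ge> \<beta>\<close> on the convex hull of \<open>Z\<close> comes from the hypothesis as follows. The bound
  \<open>f (\<rho> d) \<le> f 0\<close> along a whole half-line makes \<open>d\<close> a direction of recession: moving by \<open>d\<close> never
  increases \<open>f\<close> (\<open>recession_direction\<close>). So, up to a direction of recession, \<open>Z\<close> is closed under
  midpoints. Let \<open>D\<close> consist of the points from which some point of \<open>Z\<close> is reached along a direction
  of recession. Then \<open>D\<close> contains \<open>Z\<close>, is closed under midpoints outright, and \<open>f \<ge> \<beta>\<close>
  on \<open>D\<close>. Continuity of convex functions along lines carries the bound from a set closed under
  midpoints to its convex hull (\<open>convex_bound_midpoint_closed\<close>).

  The sandwich theorem is the Hahn-Banach theorem, in a form in which it is a statement about convex
  cones in \<open>V \<times> \<real>\<close> (\<open>Hahn_Banach_cone\<close>). There Zorn's lemma is applied to cones ordered by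
  inclusion, so that upper bounds of chains are unions, and a maximal cone turns out to be
  the epigraph of a linear functional, up to boundary points.
\<close>

section \<open>The Hahn-Banach theorem for convex cones\<close>

text \<open>
  Call a cone proper if it contains no point \<open>(0, r)\<close> with \<open>r < 0\<close>. If adding the ray through
  \<open>(v, r)\<close> keeps the cone proper, then \<open>(v, r)\<close> belongs to it by maximality. Otherwise some point
  of the cone plus a positive multiple of \<open>(v, r)\<close> is such a point \<open>(0, q)\<close>; dividing by the
  multiple gives the second alternative.
\<close>

lemma maximal_cone_dichotomy:
  fixes M :: "('a::real_vector \<times> real) set"
  assumes cone: "convex_cone M"
    and proper: "\<And>r. (0, r) \<in> M \<Longrightarrow> 0 \<le> r"
    and maximal: "\<And>X. \<lbrakk>convex_cone X; \<And>r. (0, r) \<in> X \<Longrightarrow> 0 \<le> r; M \<subseteq> X\<rbrakk> \<Longrightarrow> X = M"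
  shows "(v, r) \<in> M \<or> (\<exists>r'. (- v, r') \<in> M \<and> r' + r < 0)"
proof (rule disjCI)
  assume no: "\<not> (\<exists>r'. (- v, r') \<in> M \<and> r' + r < 0)"
  define X where "X = {m + t *\<^sub>R (v, r) |m t. m \<in> M \<and> 0 \<le> t}"
  have "M \<subseteq> X"
  proof
    fix m assume "m \<in> M"
    then have "m + 0 *\<^sub>R (v, r) \<in> X"
      unfolding X_def by blast
    then show "m \<in> X" by (simp only: scaleR_zero_left add_0_right)
  qed
  have "convex_cone X"
    unfolding convex_cone_iff
  proof (intro conjI ballI allI impI)
    show "0 \<in> X"
      using convex_cone_contains_0[OF cone] \<open>M \<subseteq> X\<close> by blast
  next
    fix x y assume "x \<in> X" "y \<in> X"
    then obtain m t n s where *: "x = m + t *\<^sub>R (v, r)" "y = n + s *\<^sub>R (v, r)"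
      "m \<in> M" "n \<in> M" "0 \<le> t" "0 \<le> s"
      by (auto simp: X_def)
    have "x + y = (m + n) + (t + s) *\<^sub>R (v, r)"
      unfolding * scaleR_left_distrib by (simp only: ac_simps)
    then show "x + y \<in> X"
      unfolding X_def using convex_cone_add[OF cone] * by fastforce
  next
    fix x c assume "x \<in> X" "0 \<le> (c::real)"
    then obtain m t where *: "x = m + t *\<^sub>R (v, r)" "m \<in> M" "0 \<le> t"
      by (auto simp: X_def)
    have "c *\<^sub>R x = c *\<^sub>R m + (c * t) *\<^sub>R (v, r)"
      unfolding * scaleR_right_distrib by simp
    then show "c *\<^sub>R x \<in> X"
      unfolding X_def using convex_cone_scaleR[OF cone] * \<open>0 \<le> c\<close> by fastforce
  qed
  moreover have "0 \<le> q" if "(0, q) \<in> X" for q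
  proof -
    obtain x s t where *: "(x, s) \<in> M" "0 \<le> t" "0 = x + t *\<^sub>R v" "q = s + t * r"
      using \<open>(0, q) \<in> X\<close> by (auto simp: X_def)
    show ?thesis
    proof (cases "t = 0")
      case True
      then show ?thesis using * proper by simp
    next
      case False
      have "x = - (t *\<^sub>R v)"
        using *(3) by (simp add: eq_neg_iff_add_eq_0)
      then have "(1 / t) *\<^sub>R (x, s) = (- v, s / t)"
        using False by simp
      then have "(- v, s / t) \<in> M"
        using convex_cone_scaleR[OF cone, of "1 / t" "(x, s)"] * by simp
      then have "0 \<le> s / t + r"
        using no by force
      then have "0 \<le> t * (s / t + r)"
        using * by simp
      then show ?thesis
        using False * by (simp add: distrib_left)
    qed
  qed
  moreover note \<open>M \<subseteq> X\<close>
  ultimately have "X = M"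
    by (rule maximal)
  moreover have "0 + 1 *\<^sub>R (v, r) \<in> X"
    unfolding X_def using convex_cone_contains_0[OF cone] zero_le_one by blast
  ultimately show "(v, r) \<in> M" by simp
qed

lemma odd_sublinear_imp_linear:
  fixes p :: "'a::real_vector \<Rightarrow> real"
  assumes add: "\<And>x y. p (x + y) \<le> p x + p y"
    and scale: "\<And>t x. 0 < t \<Longrightarrow> p (t *\<^sub>R x) \<le> t * p x"
    and odd: "\<And>x. p (- x) = - p x"
  shows "linear p"
proof (rule linearI)
  fix x y
  have "p (- x + - y) \<le> p (- x) + p (- y)"
    by (rule add)
  then show "p (x + y) = p x + p y"
    using add[of x y] odd[of "x + y"] by (simp add: odd)
next
  have pos: "p (t *\<^sub>R x) = t * p x" if "0 < t" for t x
    using scale[OF that, of x] scale[OF that, of "- x"] by (simp add: odd)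
  have zero: "p 0 = 0"
    using odd[of 0] by simp
  fix t :: real and x
  consider "0 < t" | "t = 0" | "0 < - t" by linarith
  then show "p (t *\<^sub>R x) = t *\<^sub>R p x"
  proof cases
    case 3
    have "p (t *\<^sub>R x) = - p ((- t) *\<^sub>R x)"
      using odd[of "(- t) *\<^sub>R x"] by simp
    then show ?thesis
      using pos[OF 3, of x] by simp
  qed (simp_all add: pos zero)
qed

text \<open>
  The functional is the lower boundary of a maximal proper cone \<open>M \<supseteq> C\<close>, that is
  \<open>p v = inf {r. (v, r) \<in> M}\<close>. Properness of \<open>M\<close> gives \<open>p v + p (- v) \<ge> 0\<close>, and the dichotomy
  for maximal cones gives the opposite inequality, so the sublinear function \<open>p\<close> is odd. That
  \<open>C\<close> meets every vertical line makes \<open>p\<close> finite.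
\<close>

lemma Hahn_Banach_cone:
  fixes C :: "('a::real_vector \<times> real) set"
  assumes cone: "convex_cone C"
    and proper: "\<And>r. (0, r) \<in> C \<Longrightarrow> 0 \<le> r"
    and total: "\<And>v. \<exists>r. (v, r) \<in> C"
  obtains L where "linear L" "\<And>v r. (v, r) \<in> C \<Longrightarrow> L v \<le> r"
proof -
  define \<A> where "\<A> = {X. convex_cone X \<and> (\<forall>r. (0, r) \<in> X \<longrightarrow> 0 \<le> r) \<and> C \<subseteq> X}"
  have "\<exists>M\<in>\<A>. \<forall>X\<in>\<A>. M \<subseteq> X \<longrightarrow> X = M"
  proof (rule subset_Zorn_nonempty)
    show "\<A> \<noteq> {}"
      using cone proper unfolding \<A>_def by blast
  next
    fix \<C> assume ne: "\<C> \<noteq> {}" and chain: "subset.chain \<A> \<C>"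
    have mem: "X \<in> \<A>" if "X \<in> \<C>" for X
      using chain that by (auto simp: subset_chain_def)
    have cones: "convex_cone X" if "X \<in> \<C>" for X
      using mem[OF that] by (simp add: \<A>_def)
    have "convex_cone (\<Union>\<C>)"
      unfolding convex_cone_iff
    proof (intro conjI ballI allI impI)
      show "0 \<in> \<Union>\<C>"
        using ne convex_cone_contains_0[OF cones] by blast
    next
      fix x y assume "x \<in> \<Union>\<C>" "y \<in> \<Union>\<C>"
      then obtain X where "X \<in> \<C>" "x \<in> X" "y \<in> X"
        using chain unfolding subset_chain_def by blast
      then show "x + y \<in> \<Union>\<C>"
        using convex_cone_add[OF cones] by blast
    next
      fix x c assume "x \<in> \<Union>\<C>" "0 \<le> (c::real)"
      then show "c *\<^sub>R x \<in> \<Union>\<C>"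
        using convex_cone_scaleR[OF cones] by blast
    qed
    then show "\<Union>\<C> \<in> \<A>"
      using ne mem unfolding \<A>_def by blast
  qed
  then obtain M where "M \<in> \<A>" and max: "\<And>X. \<lbrakk>X \<in> \<A>; M \<subseteq> X\<rbrakk> \<Longrightarrow> X = M"
    by blast
  then have M: "convex_cone M" "\<And>r. (0, r) \<in> M \<Longrightarrow> 0 \<le> r" "C \<subseteq> M"
    by (auto simp: \<A>_def)
  have dich: "(v, r) \<in> M \<or> (\<exists>r'. (- v, r') \<in> M \<and> r' + r < 0)" for v r
    using M(3) by (intro maximal_cone_dichotomy M max) (auto simp: \<A>_def)
  have opp: "0 \<le> r + r'" if "(v, r) \<in> M" "(- v, r') \<in> M" for v r r'
    using convex_cone_add[OF M(1) that] M(2) by simp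
  define p where "p v = Inf {r. (v, r) \<in> M}" for v
  have ne: "{r. (v, r) \<in> M} \<noteq> {}" for v
    using total[of v] M(3) by auto
  have bdd: "bdd_below {r. (v, r) \<in> M}" for v
  proof -
    obtain s where "(- v, s) \<in> M"
      using ne[of "- v"] by auto
    then have "- s \<le> r" if "(v, r) \<in> M" for r
      using opp[OF that] by force
    then show ?thesis by (intro bdd_belowI[of _ "- s"]) auto
  qed
  have p_le: "p v \<le> r" if "(v, r) \<in> M" for v r
    unfolding p_def using that bdd by (auto intro: cInf_lower)
  have p_ge: "c \<le> p v" if "\<And>r. (v, r) \<in> M \<Longrightarrow> c \<le> r" for v c
    unfolding p_def using that by (intro cInf_greatest ne) auto
  have "linear p"
  proof (rule odd_sublinear_imp_linear)
    fix x y
    have "p (x + y) - s \<le> r" if "(x, r) \<in> M" "(y, s) \<in> M" for r s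
      using p_le convex_cone_add[OF M(1) that] by fastforce
    then have "p (x + y) - s \<le> p x" if "(y, s) \<in> M" for s
      using p_ge that by blast
    then have "p (x + y) - p x \<le> p y"
      by (intro p_ge) fastforce
    then show "p (x + y) \<le> p x + p y" by simp
  next
    fix t :: real and x assume t: "0 < t"
    have "p (t *\<^sub>R x) / t \<le> p x"
    proof (rule p_ge)
      fix r assume "(x, r) \<in> M"
      then have "(t *\<^sub>R x, t * r) \<in> M"
        using convex_cone_scaleR[OF M(1), of t "(x, r)"] t by simp
      then show "p (t *\<^sub>R x) / t \<le> r"
        using p_le t by (fastforce simp: field_simps)
    qed
    then show "p (t *\<^sub>R x) \<le> t * p x"
      using t by (simp add: field_simps)
  next
    fix x
    have "- r \<le> p (- x)" if "(x, r) \<in> M" for r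
      using opp[OF that] by (intro p_ge) force
    then have "- p (- x) \<le> p x"
      by (intro p_ge) force
    moreover have "p (- x) \<le> - p x"
    proof (rule ccontr)
      assume "\<not> ?thesis"
      then have "- p (- x) < p x" by simp
      then obtain r where r: "- p (- x) < r" "r < p x"
        using dense by blast
      \<comment> \<open>The point \<open>(x, r)\<close> lies below \<open>M\<close>, and a point \<open>(- x, r')\<close> with \<open>r' < - r\<close> would lie
        below \<open>M\<close> as well.\<close>
      then have "(x, r) \<notin> M"
        using p_le by force
      then obtain r' where "(- x, r') \<in> M" "r' + r < 0"
        using dich by blast
      then show False
        using p_le[of "- x" r'] r by simp
    qed
    ultimately show "p (- x) = - p x" by simp
  qed
  moreover have "p v \<le> r" if "(v, r) \<in> C" for v r
    using p_le M(3) that by blast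
  ultimately show ?thesis ..
qed

section \<open>An affine function between a convex function and a lower bound on a convex set\<close>

text \<open>
  The cone generated by the epigraph of \<open>g\<close> over \<open>S\<close>, with the middle coordinate recording the
  scaling factor. The coordinates are grouped so that the cone lies in \<open>V \<times> \<real>\<close> with
  \<open>V = 'a \<times> \<real>\<close>, since affine functions on \<open>'a\<close> are linear functionals on \<open>V\<close>.
\<close>

definition epigraph_cone :: "'a::real_vector set \<Rightarrow> ('a \<Rightarrow> real) \<Rightarrow> (('a \<times> real) \<times> real) set" where
  "epigraph_cone S g = {((a *\<^sub>R y, a), r) |a y r. 0 \<le> a \<and> y \<in> S \<and> a * g y \<le> r}"

lemma convex_cone_epigraph_cone:
  assumes g: "convex_on S g" and ne: "S \<noteq> {}"
  shows "convex_cone (epigraph_cone S g)"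
  unfolding convex_cone_iff
proof (intro conjI ballI allI impI)
  show "0 \<in> epigraph_cone S g"
    using ne by (auto simp: epigraph_cone_def zero_prod_def)
next
  fix p q assume "p \<in> epigraph_cone S g" "q \<in> epigraph_cone S g"
  then obtain a x r b y s where p: "p = ((a *\<^sub>R x, a), r)" "0 \<le> a" "x \<in> S" "a * g x \<le> r"
    and q: "q = ((b *\<^sub>R y, b), s)" "0 \<le> b" "y \<in> S" "b * g y \<le> s"
    unfolding epigraph_cone_def by blast
  have "\<exists>w\<in>S. (a + b) *\<^sub>R w = a *\<^sub>R x + b *\<^sub>R y \<and> (a + b) * g w \<le> a * g x + b * g y"
  proof (cases "a + b = 0")
    case True
    then have "a = 0" "b = 0" using p q by auto
    then show ?thesis using p by auto
  next
    case False
    define w where "w = (a / (a + b)) *\<^sub>R x + (b / (a + b)) *\<^sub>R y"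
    have ab: "0 < a + b" using False p q by simp
    then have uv: "0 \<le> a / (a + b)" "0 \<le> b / (a + b)" "a / (a + b) + b / (a + b) = 1"
      using p q by (auto simp: add_divide_distrib[symmetric])
    have "w \<in> S"
      unfolding w_def using convex_on_imp_convex[OF g] p q uv by (auto intro: convexD)
    moreover have "g w \<le> a / (a + b) * g x + b / (a + b) * g y"
      unfolding w_def using g p(3) q(3) uv by (simp only: convex_on_def)
    then have "g w \<le> (a * g x + b * g y) / (a + b)"
      by (simp add: add_divide_distrib)
    then have "(a + b) * g w \<le> a * g x + b * g y"
      using ab by (simp add: pos_le_divide_eq mult.commute)
    moreover have "(a + b) *\<^sub>R w = a *\<^sub>R x + b *\<^sub>R y"
      using ab by (simp add: w_def scaleR_right_distrib)
    ultimately show ?thesis by blast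
  qed
  then obtain w where "w \<in> S" "a *\<^sub>R x + b *\<^sub>R y = (a + b) *\<^sub>R w" "(a + b) * g w \<le> r + s"
    using p q by fastforce
  then show "p + q \<in> epigraph_cone S g"
    using p q unfolding epigraph_cone_def by fastforce
next
  fix p c assume "p \<in> epigraph_cone S g" "0 \<le> (c::real)"
  then obtain a x r where p: "p = ((a *\<^sub>R x, a), r)" "0 \<le> a" "x \<in> S" "a * g x \<le> r"
    by (auto simp: epigraph_cone_def)
  have "(c * a) * g x \<le> c * r"
    using mult_left_mono[OF p(4) \<open>0 \<le> c\<close>] by (simp add: mult.assoc)
  then show "c *\<^sub>R p \<in> epigraph_cone S g"
    using p \<open>0 \<le> c\<close> unfolding epigraph_cone_def by fastforce
qed

text \<open>
  With \<open>A x = L (x, 1)\<close>, the conditions \<open>A \<le> f\<close> and \<open>A \<ge> \<beta>\<close> on \<open>W\<close> are upper bounds for the linear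
  functional \<open>L\<close> at the points \<open>(x, 1)\<close> and \<open>(- w, - 1)\<close>. These bounds generate the sum of the
  epigraph cone of \<open>f\<close> and the epigraph cone of \<open>- \<beta>\<close> on \<open>W\<close>, the latter reflected in \<open>V\<close>.
  A point \<open>(0, r)\<close> of the sum comes from a pair with the same scaling factor and, unless this
  factor is \<open>0\<close>, the same point of \<open>W\<close>. So \<open>r \<ge> 0\<close> for all such points says exactly that
  \<open>f \<ge> \<beta>\<close> on \<open>W\<close>.
\<close>

lemma affine_sandwich:
  fixes f :: "'a::real_vector \<Rightarrow> real"
  assumes f: "convex_on UNIV f" and W: "convex W" "W \<noteq> {}"
    and le: "\<And>w. w \<in> W \<Longrightarrow> \<beta> \<le> f w"
  obtains A where "affine_map A" "\<And>x. A x \<le> f x" "\<And>w. w \<in> W \<Longrightarrow> \<beta> \<le> A w"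
proof -
  define P where "P = epigraph_cone UNIV f"
  define Q where "Q = (\<lambda>(v, r). (- v, r)) ` epigraph_cone W (\<lambda>_. - \<beta>)"
  define C where "C = (\<Union>x\<in>P. \<Union>y\<in>Q. {x + y})"
  have "linear (\<lambda>(v :: 'a \<times> real, r :: real). (- v, r))"
    by (rule linearI) auto
  moreover have "convex_on W (\<lambda>_. - \<beta>)"
    using W by (simp add: convex_on_const)
  ultimately have "convex_cone Q"
    unfolding Q_def using W by (intro convex_cone_linear_image conjI convex_cone_epigraph_cone)
  then have cone: "convex_cone C"
    unfolding C_def P_def using f by (intro convex_cone_sums convex_cone_epigraph_cone) auto
  have C_I: "((a *\<^sub>R y - b *\<^sub>R w, a - b), a * f y - b * \<beta>) \<in> C"
    if "0 \<le> a" "0 \<le> b" "w \<in> W" for a b y w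
  proof -
    have "((a *\<^sub>R y, a), a * f y) \<in> P"
      using that by (auto simp: P_def epigraph_cone_def)
    moreover have "((b *\<^sub>R w, b), b * (- \<beta>)) \<in> epigraph_cone W (\<lambda>_. - \<beta>)"
      using that unfolding epigraph_cone_def by blast
    then have "((- (b *\<^sub>R w), - b), - (b * \<beta>)) \<in> Q"
      unfolding Q_def by (force intro: rev_image_eqI)
    ultimately show ?thesis
      unfolding C_def by force
  qed
  have proper: "0 \<le> r" if zero: "(0, r) \<in> C" for r
  proof -
    obtain p q where pq: "p \<in> P" "q \<in> Q" "(0, r) = p + q"
      using zero by (auto simp: C_def)
    obtain a y s where p: "p = ((a *\<^sub>R y, a), s)" "0 \<le> a" "a * f y \<le> s"
      using pq by (auto simp: P_def epigraph_cone_def)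
    obtain q' where q': "q' \<in> epigraph_cone W (\<lambda>_. - \<beta>)" "q = (- fst q', snd q')"
      using pq by (auto simp: Q_def)
    obtain b w t where "q' = ((b *\<^sub>R w, b), t)" "w \<in> W" "b * - \<beta> \<le> t"
      using q'(1) unfolding epigraph_cone_def by blast
    with q' have q: "q = ((- (b *\<^sub>R w), - b), t)" "w \<in> W" "- (b * \<beta>) \<le> t"
      by auto
    have eq: "a *\<^sub>R y = a *\<^sub>R w" "a = b" "r = s + t"
      using pq p q by (auto simp: zero_prod_def)
    have "a * \<beta> \<le> a * f y"
      using eq le[OF q(2)] p(2) by (cases "a = 0") (auto intro: mult_left_mono)
    then show "0 \<le> r"
      using eq p q by simp
  qed
  have total: "\<exists>r. (v, r) \<in> C" for v
  proof -
    obtain x s where v: "v = (x, s)" by force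
    obtain w where w: "w \<in> W" using W by blast
    \<comment> \<open>Any decomposition \<open>s = a - b\<close> with \<open>a > 0\<close> and \<open>b \<ge> 0\<close> works.\<close>
    define a b where "a = \<bar>s\<bar> + 1" and "b = a - s"
    have "0 < a" "0 \<le> b" by (auto simp: a_def b_def)
    then show ?thesis
      using C_I[of a b w "(1 / a) *\<^sub>R (x + b *\<^sub>R w)"] w v by (auto simp: b_def)
  qed
  obtain L where L: "linear L" and L_le: "\<And>v r. (v, r) \<in> C \<Longrightarrow> L v \<le> r"
    using Hahn_Banach_cone[OF cone proper total] by blast
  define A where "A x = L (x, 1)" for x
  show ?thesis
  proof
    have "L (x, 1) = L (x, 0) + L (0, 1)" for x
      using linear_add[OF L, of "(x, 0)" "(0, 1)"] by simp
    moreover have "linear (\<lambda>x. L (x, 0))"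
    proof (rule linearI)
      show "L (x + y, 0) = L (x, 0) + L (y, 0)" for x y
        using linear_add[OF L, of "(x, 0)" "(y, 0)"] by simp
      show "L (c *\<^sub>R x, 0) = c *\<^sub>R L (x, 0)" for c x
        using linear_scale[OF L, of c "(x, 0)"] by simp
    qed
    ultimately show "affine_map A"
      unfolding affine_map_def A_def by blast
  next
    fix x
    obtain w where "w \<in> W" using W by blast
    then show "A x \<le> f x"
      using L_le[OF C_I[of 1 0 w x]] by (simp add: A_def)
  next
    fix w assume "w \<in> W"
    then have "L (- (w, 1)) \<le> - \<beta>"
      using L_le[OF C_I[of 0 1 w 0]] by simp
    then show "\<beta> \<le> A w"
      unfolding linear_neg[OF L] by (simp add: A_def)
  qed
qed

section \<open>Lower bounds on sets closed under midpoints\<close>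

lemma convex_on_affine_comp:
  fixes g :: "'a::real_vector \<Rightarrow> real" and h :: "'b::real_vector \<Rightarrow> 'a"
  assumes g: "convex_on UNIV g" and h: "linear h"
  shows "convex_on UNIV (\<lambda>x. g (h x + b))"
  unfolding convex_on_def
proof (intro conjI ballI allI impI convex_UNIV)
  fix x y and u v :: real assume uv: "0 \<le> u" "0 \<le> v" "u + v = 1"
  have "h (u *\<^sub>R x + v *\<^sub>R y) + b = u *\<^sub>R (h x + b) + v *\<^sub>R (h y + b)"
    using uv(3) by (simp add: linear_add[OF h] linear_scale[OF h] scaleR_right_distrib
        flip: scaleR_left_distrib[of u v b, unfolded uv(3) scaleR_one])
  then show "g (h (u *\<^sub>R x + v *\<^sub>R y) + b) \<le> u * g (h x + b) + v * g (h y + b)"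
    using g uv by (simp add: convex_on_def)
qed

text \<open>
  A point of the interval outside \<open>T\<close> lies in a gap of \<open>T\<close> whose end points belong to \<open>T\<close>, and
  the midpoint of the gap contradicts this.
\<close>

lemma closed_midpoint_closed_real:
  fixes T :: "real set"
  assumes cl: "closed T" and mid: "\<And>s t. \<lbrakk>s \<in> T; t \<in> T\<rbrakk> \<Longrightarrow> (s + t) / 2 \<in> T"
    and ab: "a \<in> T" "b \<in> T" and t: "a \<le> t" "t \<le> b"
  shows "t \<in> T"
proof (rule ccontr)
  assume "t \<notin> T"
  define l where "l = Sup (T \<inter> {..t})"
  define u where "u = Inf (T \<inter> {t..})"
  have bdd: "bdd_above (T \<inter> {..t})" "bdd_below (T \<inter> {t..})"
    by auto
  have "l \<in> T \<inter> {..t}"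
    unfolding l_def using ab t cl bdd by (intro closed_contains_Sup) auto
  moreover have "u \<in> T \<inter> {t..}"
    unfolding u_def using ab t cl bdd by (intro closed_contains_Inf) auto
  ultimately have lu: "l \<in> T" "u \<in> T" "l < t" "t < u"
    using \<open>t \<notin> T\<close> by (auto simp: less_le)
  have "(l + u) / 2 \<in> T"
    using mid lu by blast
  moreover have "s \<le> l" if "s \<in> T" "s \<le> t" for s
    unfolding l_def using that bdd by (auto intro: cSup_upper)
  moreover have "u \<le> s" if "s \<in> T" "t \<le> s" for s
    unfolding u_def using that bdd by (auto intro: cInf_lower)
  ultimately have "(l + u) / 2 \<le> l \<or> u \<le> (l + u) / 2"
    using linear by blast
  then show False using lu by simp
qed

text \<open>
  Let \<open>W\<close> consist of the points at which every convex function that is at least \<open>\<beta>\<close> on \<open>D\<close> is at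
  least \<open>\<beta>\<close>. Considering all convex functions at once makes \<open>W\<close> inherit closure under midpoints
  from \<open>D\<close>, because \<open>x \<mapsto> g ((x + z) / 2)\<close> is again convex. On a line \<open>W\<close> is
  closed by continuity of convex functions, so \<open>W\<close> is convex and contains the hull of \<open>D\<close>.
\<close>

lemma convex_bound_midpoint_closed:
  fixes f :: "'a::real_vector \<Rightarrow> real"
  assumes f: "convex_on UNIV f" and le: "\<And>d. d \<in> D \<Longrightarrow> \<beta> \<le> f d"
    and mid: "\<And>x y. \<lbrakk>x \<in> D; y \<in> D\<rbrakk> \<Longrightarrow> (1/2) *\<^sub>R x + (1/2) *\<^sub>R y \<in> D"
    and w: "w \<in> convex hull D"
  shows "\<beta> \<le> f w"
proof -
  define G where "G = {g. convex_on UNIV g \<and> (\<forall>d\<in>D. \<beta> \<le> g d)}"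
  define W where "W = {w. \<forall>g\<in>G. \<beta> \<le> g w}"
  have half: "convex_on UNIV (\<lambda>x. g ((1/2) *\<^sub>R x + z))" if "g \<in> G" for g z
    using that by (intro convex_on_affine_comp) (auto simp: G_def linear_scale_self)
  have mid_W: "(1/2) *\<^sub>R x + (1/2) *\<^sub>R y \<in> W" if x: "x \<in> W" and y: "y \<in> W" for x y
    unfolding W_def
  proof (intro CollectI ballI)
    fix g assume g: "g \<in> G"
    \<comment> \<open>One argument at a time is moved from \<open>D\<close> to \<open>W\<close>.\<close>
    have "\<beta> \<le> g ((1/2) *\<^sub>R d + (1/2) *\<^sub>R x)" if "d \<in> D" for d
    proof -
      have "(\<lambda>x. g ((1/2) *\<^sub>R x + (1/2) *\<^sub>R d)) \<in> G"
        using half[OF g] g mid that by (auto simp: G_def)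
      then show ?thesis using x by (auto simp: W_def add.commute)
    qed
    then have "(\<lambda>y. g ((1/2) *\<^sub>R y + (1/2) *\<^sub>R x)) \<in> G"
      using half[OF g] by (auto simp: G_def)
    then show "\<beta> \<le> g ((1/2) *\<^sub>R x + (1/2) *\<^sub>R y)"
      using y by (auto simp: W_def add.commute)
  qed
  have "convex W"
  proof (rule convexI)
    fix x y and u v :: real
    assume xy: "x \<in> W" "y \<in> W" and uv: "0 \<le> u" "0 \<le> v" "u + v = 1"
    define T where "T = {t. t *\<^sub>R (y - x) + x \<in> W}"
    have "v \<in> T"
    proof (rule closed_midpoint_closed_real)
      have "continuous_on UNIV (\<lambda>t. g (t *\<^sub>R (y - x) + x))" if "g \<in> G" for g
        using that by (intro convex_on_continuous convex_on_affine_comp)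
          (auto simp: G_def intro: linearI scaleR_left_distrib)
      then have "closed {t. \<beta> \<le> g (t *\<^sub>R (y - x) + x)}" if "g \<in> G" for g
        using that by (intro closed_Collect_le) auto
      then have "closed (\<Inter>g\<in>G. {t. \<beta> \<le> g (t *\<^sub>R (y - x) + x)})"
        by blast
      moreover have "T = (\<Inter>g\<in>G. {t. \<beta> \<le> g (t *\<^sub>R (y - x) + x)})"
        by (auto simp: T_def W_def)
      ultimately show "closed T" by simp
    next
      fix s t assume "s \<in> T" "t \<in> T"
      then have "(1/2) *\<^sub>R (s *\<^sub>R (y - x) + x) + (1/2) *\<^sub>R (t *\<^sub>R (y - x) + x) \<in> W"
        by (intro mid_W) (auto simp: T_def)
      moreover have "(1/2) *\<^sub>R (s *\<^sub>R z + x) + (1/2) *\<^sub>R (t *\<^sub>R z + x) = ((s + t) / 2) *\<^sub>R z + x" for z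
      proof -
        have "(1/2) *\<^sub>R (s *\<^sub>R z + x) + (1/2) *\<^sub>R (t *\<^sub>R z + x)
          = (s / 2 + t / 2) *\<^sub>R z + (1/2 + 1/2) *\<^sub>R x"
          unfolding scaleR_left_distrib scaleR_right_distrib by simp
        then show ?thesis by (simp add: add_divide_distrib)
      qed
      ultimately show "(s + t) / 2 \<in> T"
        by (simp add: T_def)
    next
      show "0 \<in> T" "1 \<in> T" "0 \<le> v" "v \<le> 1"
        using xy uv by (auto simp: T_def)
    qed
    moreover have "u = 1 - v" using uv by simp
    ultimately show "u *\<^sub>R x + v *\<^sub>R y \<in> W"
      by (simp add: T_def scaleR_left_diff_distrib scaleR_right_diff_distrib add_diff_eq diff_add_eq add.commute)
  qed
  then have "convex hull D \<subseteq> W"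
    by (intro hull_minimal) (auto simp: W_def G_def)
  then show ?thesis
    using w f le by (auto simp: W_def G_def)
qed

section \<open>Directions of recession\<close>

text \<open>
  On the half-line from \<open>x\<close> in direction \<open>d\<close> the function \<open>f\<close> is bounded above by the mean of
  \<open>f (2 x)\<close> and \<open>f 0\<close>, as \<open>x + \<rho> d\<close> is the midpoint of \<open>2 x\<close> and \<open>2 \<rho> d\<close>. A convex function
  that increased between two points of a half-line would be unbounded further on.
\<close>

lemma recession_direction:
  fixes f :: "'a::real_vector \<Rightarrow> real"
  assumes f: "convex_on UNIV f" and d: "\<And>\<rho>. 0 \<le> \<rho> \<Longrightarrow> f (\<rho> *\<^sub>R d) \<le> f 0"
  shows "f (x + d) \<le> f x"
proof (rule ccontr)
  define K where "K = 1/2 * f (2 *\<^sub>R x) + 1/2 * f 0"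
  have bound: "f (x + \<rho> *\<^sub>R d) \<le> K" if "0 \<le> \<rho>" for \<rho>
  proof -
    have "f ((1/2) *\<^sub>R (2 *\<^sub>R x) + (1/2) *\<^sub>R ((2 * \<rho>) *\<^sub>R d))
      \<le> 1/2 * f (2 *\<^sub>R x) + 1/2 * f ((2 * \<rho>) *\<^sub>R d)"
      using convex_onD[OF f, of "1/2" "2 *\<^sub>R x" "(2 * \<rho>) *\<^sub>R d"] by simp
    then show ?thesis
      using d[of "2 * \<rho>"] that by (simp add: K_def)
  qed
  assume "\<not> ?thesis"
  then have pos: "0 < f (x + d) - f x" by simp
  obtain n where n: "K - f x < real n * (f (x + d) - f x)"
    using reals_Archimedean3[OF pos] by blast
  define \<rho> where "\<rho> = real n + 1"
  have \<rho>: "1 \<le> \<rho>" by (simp add: \<rho>_def)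
  have "f ((1 - 1/\<rho>) *\<^sub>R x + (1/\<rho>) *\<^sub>R (x + \<rho> *\<^sub>R d)) \<le> (1 - 1/\<rho>) * f x + (1/\<rho>) * f (x + \<rho> *\<^sub>R d)"
    using convex_onD[OF f, of "1/\<rho>" x "x + \<rho> *\<^sub>R d"] \<rho> by simp
  moreover have "(1 - 1/\<rho>) *\<^sub>R x + (1/\<rho>) *\<^sub>R (x + \<rho> *\<^sub>R d) = x + d"
    using \<rho> by (simp add: algebra_simps)
  ultimately have "f (x + d) \<le> (1 - 1/\<rho>) * f x + (1/\<rho>) * K"
    using bound[of \<rho>] \<rho> mult_left_mono[of "f (x + \<rho> *\<^sub>R d)" K "1/\<rho>"] by simp
  then have "\<rho> * (f (x + d) - f x) \<le> K - f x"
    using \<rho> by (simp add: field_simps)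
  then show False
    using n pos by (simp add: \<rho>_def distrib_right)
qed

text \<open>
  The points \<open>w\<close> for which some \<open>z \<in> Z\<close> has \<open>z - w\<close> among the directions of recession form a set
  closed under midpoints, since the directions of recession form a convex cone.
\<close>

lemma convex_bound_hull:
  fixes f :: "'a::real_vector \<Rightarrow> real"
  assumes f: "convex_on UNIV f" and le: "\<And>z. z \<in> Z \<Longrightarrow> \<beta> \<le> f z"
    and Z: "\<And>z1 z2. \<lbrakk>z1 \<in> Z; z2 \<in> Z\<rbrakk> \<Longrightarrow>
      \<exists>z\<in>Z. \<forall>\<rho>\<ge>0. f (\<rho> *\<^sub>R (z - (1/2) *\<^sub>R z1 - (1/2) *\<^sub>R z2)) \<le> f 0"
    and w: "w \<in> convex hull Z"
  shows "\<beta> \<le> f w"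
proof -
  define R where "R = {d. \<forall>\<rho>\<ge>0. \<forall>x. f (x + \<rho> *\<^sub>R d) \<le> f x}"
  define D where "D = {w. \<exists>z\<in>Z. z - w \<in> R}"
  have R_I: "d \<in> R" if d: "\<forall>\<rho>\<ge>0. f (\<rho> *\<^sub>R d) \<le> f 0" for d
  proof -
    have "f (x + \<rho> *\<^sub>R d) \<le> f x" if "0 \<le> \<rho>" for \<rho> x
    proof (rule recession_direction[OF f])
      show "f (\<sigma> *\<^sub>R \<rho> *\<^sub>R d) \<le> f 0" if "0 \<le> \<sigma>" for \<sigma>
        using d \<open>0 \<le> \<rho>\<close> that by simp
    qed
    then show ?thesis by (simp add: R_def)
  qed
  have R_add: "d + e \<in> R" if "d \<in> R" "e \<in> R" for d e
  proof -
    have "f (x + \<rho> *\<^sub>R (d + e)) \<le> f x" if "0 \<le> \<rho>" for x \<rho>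
    proof -
      have "f (x + \<rho> *\<^sub>R d + \<rho> *\<^sub>R e) \<le> f (x + \<rho> *\<^sub>R d)"
        using \<open>e \<in> R\<close> that by (simp add: R_def)
      also have "\<dots> \<le> f x"
        using \<open>d \<in> R\<close> that by (simp add: R_def)
      finally show ?thesis by (simp add: scaleR_right_distrib add.assoc)
    qed
    then show ?thesis by (simp add: R_def)
  qed
  have R_half: "(1/2) *\<^sub>R d \<in> R" if "d \<in> R" for d
    using that by (fastforce simp: R_def dest: spec[of _ "_ / 2"])
  show ?thesis
  proof (rule convex_bound_midpoint_closed[OF f])
    fix d assume "d \<in> D"
    then obtain z where z: "z \<in> Z" "z - d \<in> R"
      by (auto simp: D_def)
    then have "f (d + 1 *\<^sub>R (z - d)) \<le> f d"
      unfolding R_def using zero_le_one by blast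
    then show "\<beta> \<le> f d"
      using le[OF z(1)] by simp
  next
    fix x y assume "x \<in> D" "y \<in> D"
    then obtain z1 z2 where z12: "z1 \<in> Z" "z1 - x \<in> R" "z2 \<in> Z" "z2 - y \<in> R"
      by (auto simp: D_def)
    obtain z where z: "z \<in> Z" "z - (1/2) *\<^sub>R z1 - (1/2) *\<^sub>R z2 \<in> R"
      using Z z12 R_I by blast
    have "(z - (1/2) *\<^sub>R z1 - (1/2) *\<^sub>R z2) + ((1/2) *\<^sub>R (z1 - x) + (1/2) *\<^sub>R (z2 - y)) \<in> R"
      using z z12 by (intro R_add R_half)
    moreover have "(z - (1/2) *\<^sub>R z1 - (1/2) *\<^sub>R z2) + ((1/2) *\<^sub>R (z1 - x) + (1/2) *\<^sub>R (z2 - y))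
      = z - ((1/2) *\<^sub>R x + (1/2) *\<^sub>R y)"
      unfolding scaleR_right_diff_distrib by simp
    ultimately show "(1/2) *\<^sub>R x + (1/2) *\<^sub>R y \<in> D"
      using z by (auto simp: D_def)
  next
    have "Z \<subseteq> D"
      by (force simp: D_def R_def)
    then show "w \<in> convex hull D"
      using w hull_mono by blast
  qed
qed

theorem theorem4p3:
  fixes f :: "'a::real_vector \<Rightarrow> real" and Z :: "'a set"
  assumes "convex_on UNIV f"
    and "Z \<noteq> {}"
    and "\<forall>z1\<in>Z. \<forall>z2\<in>Z. \<exists>z\<in>Z. \<forall>\<rho>::real. \<rho> \<ge> 0 \<longrightarrow>
           f (\<rho> *\<^sub>R (z - (1/2) *\<^sub>R z1 - (1/2) *\<^sub>R z2)) \<le> f 0"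
  shows "\<exists>A. affine_map A \<and> (\<forall>x. A x \<le> f x) \<and>
           (INF z\<in>Z. ereal (A z)) = (INF z\<in>Z. ereal (f z))"
proof (cases "(INF z\<in>Z. ereal (f z)) = -\<infinity>")
  case True
  obtain A where A: "affine_map A" "\<And>x. A x \<le> f x"
    using affine_sandwich[OF assms(1), of "{0}" "f 0"] by auto
  then have "(INF z\<in>Z. ereal (A z)) \<le> (INF z\<in>Z. ereal (f z))"
    by (intro INF_mono) auto
  then have "(INF z\<in>Z. ereal (A z)) = (INF z\<in>Z. ereal (f z))"
    using True by simp
  then show ?thesis
    using A by blast
next
  case False
  obtain z0 where "z0 \<in> Z" using assms(2) by blast
  then have "(INF z\<in>Z. ereal (f z)) \<le> ereal (f z0)"
    by (rule INF_lower)
  then obtain \<beta> where \<beta>: "(INF z\<in>Z. ereal (f z)) = ereal \<beta>"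
    using False by (cases "INF z\<in>Z. ereal (f z)") auto
  have le: "\<beta> \<le> f z" if "z \<in> Z" for z
    using INF_lower[OF that, of "\<lambda>z. ereal (f z)"] \<beta> by simp
  have bound: "\<beta> \<le> f w" if "w \<in> convex hull Z" for w
    using convex_bound_hull[OF assms(1) le _ that] assms(3) by blast
  obtain A where A: "affine_map A" "\<And>x. A x \<le> f x" "\<And>w. w \<in> convex hull Z \<Longrightarrow> \<beta> \<le> A w"
    using affine_sandwich[OF assms(1) convex_convex_hull _ bound] assms(2) by auto
  have "(INF z\<in>Z. ereal (A z)) \<le> (INF z\<in>Z. ereal (f z))"
    using A by (intro INF_mono) auto
  moreover have "ereal \<beta> \<le> (INF z\<in>Z. ereal (A z))"
    using A(3) hull_inc[of _ Z convex] by (intro INF_greatest) auto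
  ultimately show ?thesis
    using A \<beta> by (metis order_antisym)
qed

end
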